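(* Let $G=(V,E,w)$ be a graph with positive integer edge weights and let $k\in\mathbb{N}$ with $k\le|V|$. Let $\mathcal{U}$ be the uniform distribution over all $2^{|V|}$ cuts of $G$. Then $\mu(\mathcal{U},k,G)\ge\frac12\max_{\mathcal{D}}\mu(\mathcal{D},k,G)$, the maximum ranging over all probability distributions $\mathcal{D}$ on subsets of $V$; i.e., $\mathcal{U}$ is a $1/2$-approximation for fault tolerant Max-Cut with $k$ faults against an oblivious adversary.
   Context: For $S\subseteq V$, $C_{S,G}$ is the total weight of edges with exactly one endpoint in $S$; for $F\subseteq V$, $G-F$ deletes the vertices of $F$ and incident edges. For a distribution $\mathcal{D}$ over subsets of $V$, $\mu(\mathcal{D},k,G)=\min_{F\subseteq V,|F|=k}\mathbb{E}_{S\sim\mathcal{D}}[C_{S-F,G-F}]$. *)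

theory Defs
  imports "HOL-Probability.Probability"
begin

record 'a wgraph =
  verts :: "'a set"
  edges :: "'a set set"
  weight :: "'a set \<Rightarrow> nat"

text \<open>Finite, simple and undirected: an edge is the two-element set of its endpoints.\<close>

definition wf_wgraph :: "'a wgraph \<Rightarrow> bool" where
  "wf_wgraph G \<longleftrightarrow>
     finite (verts G) \<and>
     (\<forall>e\<in>edges G. e \<subseteq> verts G \<and> card e = 2) \<and>
     (\<forall>e\<in>edges G. weight G e > 0)"

definition delete_verts :: "'a wgraph \<Rightarrow> 'a set \<Rightarrow> 'a wgraph" where
  "delete_verts G F =
     \<lparr>verts = verts G - F, edges = {e \<in> edges G. e \<inter> F = {}}, weight = weight G\<rparr>"

definition cut_weight :: "'a set \<Rightarrow> 'a wgraph \<Rightarrow> nat" where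
  "cut_weight S G = (\<Sum>e | e \<in> edges G \<and> card (e \<inter> S) = 1. weight G e)"

definition cut_distributions :: "'a wgraph \<Rightarrow> 'a set pmf set" where
  "cut_distributions G = {D. set_pmf D \<subseteq> Pow (verts G)}"

definition uniform_cut :: "'a wgraph \<Rightarrow> 'a set pmf" where
  "uniform_cut G = pmf_of_set (Pow (verts G))"

text \<open>The minimum is over a finite set, which is nonempty only for \<open>k \<le> card (verts G)\<close>.\<close>

definition fault_value :: "'a set pmf \<Rightarrow> nat \<Rightarrow> 'a wgraph \<Rightarrow> real" where
  "fault_value D k G =
     (MIN F \<in> {F. F \<subseteq> verts G \<and> card F = k}.
        measure_pmf.expectation D (\<lambda>S. real (cut_weight (S - F) (delete_verts G F))))"

end

theory Submission
  imports Defs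
begin

text \<open>
  An edge of \<open>G - F\<close> is cut by a uniformly random set with probability \<open>1/2\<close>, since toggling one
  endpoint exchanges the sets that cut it with those that do not. So for every fault set \<open>F\<close> the
  uniform distribution achieves half of the total weight of \<open>G - F\<close>, and no distribution achieves
  more than that total. The maximum is attained because the distributions form a compact simplex
  on which the value, a minimum of finitely many linear functions, is continuous.
\<close>

text \<open>Toggling \<open>a\<close> changes the size of the intersection by exactly one, hence
  flips its parity; among the possible sizes 0, 1 and 2 only 1 is odd.\<close>

lemma card_Int_toggle_eq_1:
  assumes "a \<noteq> b"
  shows "card ({a, b} \<inter> sym_diff S {a}) = 1 \<longleftrightarrow> card ({a, b} \<inter> S) \<noteq> 1"
proof -
  have "{a, b} \<inter> sym_diff S {a} = (if a \<in> S then {} else {a}) \<union> (if b \<in> S then {b} else {})"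
    using assms by auto
  moreover have "{a, b} \<inter> S = (if a \<in> S then {a} else {}) \<union> (if b \<in> S then {b} else {})"
    by auto
  ultimately show ?thesis
    using assms by (cases "a \<in> S"; cases "b \<in> S")
      (simp_all only: if_True if_False Un_empty_left Un_empty_right, simp_all)
qed

lemma card_cutting_sets:
  assumes "finite V" "e \<subseteq> V" "card e = 2"
  shows "2 * card {S \<in> Pow V. card (e \<inter> S) = 1} = card (Pow V)"
proof -
  obtain a b where e: "e = {a, b}" "a \<noteq> b"
    using assms(3) by (meson card_2_iff)
  have "a \<in> V" using assms(2) e by simp
  let ?C = "{S \<in> Pow V. card (e \<inter> S) = 1}" and ?N = "{S \<in> Pow V. card (e \<inter> S) \<noteq> 1}"
  have toggle: "card (e \<inter> sym_diff S {a}) = 1 \<longleftrightarrow> card (e \<inter> S) \<noteq> 1" for S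
    unfolding e(1) by (rule card_Int_toggle_eq_1[OF e(2)])
  \<comment> \<open>The toggle map is its own inverse, so it suffices that it sends each class into
    the other; \<open>a \<in> V\<close> keeps the toggled set inside \<open>V\<close>.\<close>
  have "bij_betw (\<lambda>S. sym_diff S {a}) ?C ?N"
  proof (rule bij_betwI[where g = "\<lambda>S. sym_diff S {a}"])
    show "(\<lambda>S. sym_diff S {a}) \<in> ?C \<rightarrow> ?N"
      using toggle \<open>a \<in> V\<close> by blast
    show "(\<lambda>S. sym_diff S {a}) \<in> ?N \<rightarrow> ?C"
      using toggle \<open>a \<in> V\<close> by blast
  qed auto
  then have "card ?C = card ?N"
    by (rule bij_betw_same_card)
  moreover have "card (?C \<union> ?N) = card ?C + card ?N"
    using assms(1) by (intro card_Un_disjoint) auto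
  moreover have "?C \<union> ?N = Pow V" by auto
  ultimately show ?thesis by simp
qed

lemma finite_edges: "wf_wgraph G \<Longrightarrow> finite (edges G)"
  unfolding wf_wgraph_def by (meson PowI finite_Pow_iff finite_subset subsetI)

text \<open>Edges that survive the deletion avoid \<open>F\<close>, so they cannot tell
  \<open>S - F\<close> from \<open>S\<close>. Moving the cut condition into the summand makes the
  index set independent of \<open>S\<close>, which allows both exchanging sums and bounding term by
  term.\<close>

lemma cut_weight_delete_verts:
  assumes "wf_wgraph G"
  shows "real (cut_weight (S - F) (delete_verts G F)) =
    (\<Sum>e | e \<in> edges G \<and> e \<inter> F = {}. if card (e \<inter> S) = 1 then real (weight G e) else 0)"
proof -
  have "e \<inter> (S - F) = e \<inter> S" if "e \<inter> F = {}" for e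
    using that by auto
  then have "{e. e \<in> edges (delete_verts G F) \<and> card (e \<inter> (S - F)) = 1}
      = {e \<in> {e. e \<in> edges G \<and> e \<inter> F = {}}. card (e \<inter> S) = 1}"
    by (auto simp: delete_verts_def)
  moreover have "finite {e. e \<in> edges G \<and> e \<inter> F = {}}"
    using finite_edges[OF assms] by simp
  ultimately show ?thesis
    by (simp only: cut_weight_def of_nat_sum sum.inter_filter)
      (auto simp: delete_verts_def intro!: sum.cong)
qed

lemma expectation_uniform_cut:
  assumes "wf_wgraph G"
  shows "measure_pmf.expectation (uniform_cut G)
      (\<lambda>S. real (cut_weight (S - F) (delete_verts G F))) =
    (\<Sum>e | e \<in> edges G \<and> e \<inter> F = {}. real (weight G e)) / 2"
proof -
  let ?P = "Pow (verts G)" and ?E = "{e. e \<in> edges G \<and> e \<inter> F = {}}"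
  have fin: "finite ?P" "finite (verts G)"
    using assms by (auto simp: wf_wgraph_def)
  have "(\<Sum>S\<in>?P. if card (e \<inter> S) = 1 then real (weight G e) else 0)
      = real (card ?P) * (real (weight G e) / 2)" if "e \<in> ?E" for e
  proof -
    have "2 * card {S \<in> ?P. card (e \<inter> S) = 1} = card ?P"
      using assms that fin by (intro card_cutting_sets) (auto simp: wf_wgraph_def)
    then have "real (card ?P) = 2 * real (card {S \<in> ?P. card (e \<inter> S) = 1})"
      by linarith
    then show ?thesis
      using fin(1) by (simp add: sum.inter_filter[symmetric] del: Pow_iff card_Pow)
  qed
  \<comment> \<open>Linearity of expectation: after the sums over cuts and edges are exchanged, each
    edge is averaged on its own.\<close>
  then have "(\<Sum>S\<in>?P. real (cut_weight (S - F) (delete_verts G F)))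
      = (\<Sum>e\<in>?E. real (card ?P) * (real (weight G e) / 2))"
    unfolding cut_weight_delete_verts[OF assms]
    by (subst sum.swap) (rule sum.cong[OF refl])
  also have "\<dots> = real (card ?P) * ((\<Sum>e\<in>?E. real (weight G e)) / 2)"
    by (simp only: sum_distrib_left[symmetric] sum_divide_distrib[symmetric])
  finally show ?thesis
    unfolding uniform_cut_def
    using fin by (subst integral_pmf_of_set) (auto simp: card_Pow)
qed

lemma expectation_cut_le_total:
  assumes "wf_wgraph G"
  shows "measure_pmf.expectation D
      (\<lambda>S. real (cut_weight (S - F) (delete_verts G F))) \<le>
    (\<Sum>e | e \<in> edges G \<and> e \<inter> F = {}. real (weight G e))"
proof -
  let ?f = "\<lambda>S. real (cut_weight (S - F) (delete_verts G F))"
  let ?W = "\<Sum>e | e \<in> edges G \<and> e \<inter> F = {}. real (weight G e)"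
  have le: "?f S \<le> ?W" for S
    unfolding cut_weight_delete_verts[OF assms] by (rule sum_mono) simp
  \<comment> \<open>\<open>D\<close> is arbitrary here and may have infinite support; boundedness by
    the total weight gives integrability.\<close>
  have "integrable (measure_pmf D) ?f"
    by (rule measure_pmf.integrable_const_bound[where B = ?W]) (use le in auto)
  then show ?thesis
    using le by (intro measure_pmf.integral_le_const) auto
qed

lemma fault_sets:
  assumes "wf_wgraph G" "k \<le> card (verts G)"
  shows "finite {F. F \<subseteq> verts G \<and> card F = k}" "{F. F \<subseteq> verts G \<and> card F = k} \<noteq> {}"
  using assms obtain_subset_with_card_n[of k "verts G"] by (auto simp: wf_wgraph_def)

text \<open>Both values are compared at the same \<open>F\<close>, through the total weight
  surviving \<open>F\<close>, so it does not matter which fault set is worst for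
  \<open>D\<close>.\<close>

lemma uniform_cut_half_approx:
  assumes "wf_wgraph G" "k \<le> card (verts G)"
  shows "fault_value (uniform_cut G) k G \<ge> 1 / 2 * fault_value D k G"
proof -
  let ?A = "{F. F \<subseteq> verts G \<and> card F = k}"
  let ?v = "\<lambda>D F. measure_pmf.expectation D (\<lambda>S. real (cut_weight (S - F) (delete_verts G F)))"
  have "1 / 2 * fault_value D k G \<le> ?v (uniform_cut G) F" if "F \<in> ?A" for F
  proof -
    have "fault_value D k G \<le> ?v D F"
      unfolding fault_value_def using fault_sets(1)[OF assms] that by (intro Min_le) auto
    then show ?thesis
      using expectation_cut_le_total[OF assms(1), of D F] expectation_uniform_cut[OF assms(1), of F]
      by linarith
  qed
  then show ?thesis
    unfolding fault_value_def[of "uniform_cut G"]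
    using fault_sets[OF assms] by (intro Min.boundedI) auto
qed

lemma continuous_on_Min_family:
  fixes f :: "'i \<Rightarrow> 'x::topological_space \<Rightarrow> real"
  assumes "finite A" "A \<noteq> {}" "\<And>i. i \<in> A \<Longrightarrow> continuous_on K (f i)"
  shows "continuous_on K (\<lambda>x. MIN i\<in>A. f i x)"
  using assms
proof (induction rule: finite_ne_induct)
  case (insert i A)
  then show ?case by (simp add: continuous_on_min)
qed simp

text \<open>The type \<open>'b\<close> may be infinite, so compactness comes from Tychonoff: the
  simplex is a closed hyperplane cut out of a product of compact sets, where coordinates outside
  \<open>P\<close> are pinned to \<open>{0}\<close>.\<close>

lemma compact_simplex:
  fixes P :: "'b set"
  assumes "finite P"
  shows "compact {p :: 'b \<Rightarrow> real. (\<forall>x. 0 \<le> p x) \<and> (\<forall>x. x \<notin> P \<longrightarrow> p x = 0) \<and> sum p P = 1}"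
    (is "compact ?K")
proof -
  define B where "B = (\<lambda>x. if x \<in> P then {0..1::real} else {0})"
  have "compactin (product_topology (\<lambda>_. euclidean) UNIV) (PiE UNIV B)"
    by (subst compactin_PiE) (auto simp: B_def compactin_euclidean_iff)
  then have "compact (PiE UNIV B)"
    by (simp add: euclidean_product_topology compactin_euclidean_iff)
  moreover have "closed ((\<lambda>p :: 'b \<Rightarrow> real. sum p P) -` {1})"
    by (rule closed_vimage[OF closed_singleton])
      (rule continuous_on_sum[OF continuous_on_product_coordinates])
  moreover have "?K = PiE UNIV B \<inter> (\<lambda>p. sum p P) -` {1}"
  proof -
    \<comment> \<open>The upper bound of the box is implied: \<open>p x\<close> is one of finitely
      many nonnegative terms with sum 1.\<close>
    have "p x \<le> 1" if "\<forall>x. 0 \<le> p x" "sum p P = 1" "x \<in> P" for p :: "'b \<Rightarrow> real" and x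
      using member_le_sum[of x P p] that assms by auto
    then show ?thesis
      unfolding B_def by (fastforce simp: PiE_def Pi_def split: if_splits)
  qed
  ultimately show ?thesis by (simp add: compact_Int_closed)
qed

lemma ex_max_fault_value:
  assumes "wf_wgraph G" "k \<le> card (verts G)"
  shows "\<exists>D. is_arg_max (\<lambda>D. fault_value D k G) (\<lambda>D. D \<in> cut_distributions G) D"
proof -
  let ?P = "Pow (verts G)" and ?A = "{F. F \<subseteq> verts G \<and> card F = k}"
  let ?K = "{p :: 'a set \<Rightarrow> real. (\<forall>x. 0 \<le> p x) \<and> (\<forall>x. x \<notin> ?P \<longrightarrow> p x = 0) \<and> sum p ?P = 1}"
  \<comment> \<open>The value as a function of the mass function \<open>p\<close>, so that the
    extreme value theorem can be applied on the simplex \<open>?K\<close>.\<close>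
  define h where "h = (\<lambda>p. MIN F \<in> ?A. \<Sum>S\<in>?P. real (cut_weight (S - F) (delete_verts G F)) * p S)"
  have fin: "finite ?P"
    using assms by (auto simp: wf_wgraph_def)
  have val: "fault_value D k G = h (pmf D)" and mem: "pmf D \<in> ?K"
    if D: "D \<in> cut_distributions G" for D
  proof -
    have sub: "set_pmf D \<subseteq> ?P"
      using D by (simp add: cut_distributions_def)
    then show "fault_value D k G = h (pmf D)"
      unfolding fault_value_def h_def
      by (subst integral_measure_pmf_real[OF fin]) auto
    show "pmf D \<in> ?K"
      using sum_pmf_eq_1[OF fin sub] sub by (auto simp: pmf_eq_0_set_pmf)
  qed
  have "uniform_cut G \<in> cut_distributions G"
    using fin by (simp add: cut_distributions_def uniform_cut_def Pow_not_empty del: finite_Pow_iff)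
  then have "?K \<noteq> {}"
    using mem by blast
  moreover have "continuous_on ?K h"
    unfolding h_def using fault_sets[OF assms]
    by (intro continuous_on_Min_family continuous_intros
        continuous_on_subset[OF continuous_on_product_coordinates]) auto
  ultimately have "\<exists>p\<in>?K. \<forall>q\<in>?K. h q \<le> h p"
    by (rule continuous_attains_sup[OF compact_simplex[OF fin]])
  then obtain p where p: "p \<in> ?K" "\<forall>q\<in>?K. h q \<le> h p"
    by (elim bexE)
  then have p_simplex: "\<And>S. 0 \<le> p S" "\<And>S. S \<notin> ?P \<Longrightarrow> p S = 0" "sum p ?P = 1"
    by blast+
  \<comment> \<open>The maximizer \<open>p\<close> is turned back into a distribution:
    \<open>embed_pmf\<close> requires total mass 1 over the whole type, and all mass sits on the
    finite set \<open>?P\<close>.\<close>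
  have "(\<integral>\<^sup>+S. ennreal (p S) \<partial>count_space UNIV) = (\<Sum>S\<in>?P. ennreal (p S))"
    by (rule nn_integral_count_space'[OF fin]) (auto simp: p_simplex(2))
  also have "\<dots> = ennreal (sum p ?P)"
    by (rule sum_ennreal) (rule p_simplex)
  finally have "(\<integral>\<^sup>+S. ennreal (p S) \<partial>count_space UNIV) = 1"
    by (simp only: p_simplex ennreal_1)
  then have pmf: "pmf (embed_pmf p) = p"
    by (intro ext pmf_embed_pmf p_simplex)
  have "set_pmf (embed_pmf p) \<subseteq> ?P"
  proof
    fix S assume "S \<in> set_pmf (embed_pmf p)"
    then have "p S \<noteq> 0"
      by (simp only: set_pmf_iff pmf not_False_eq_True)
    then show "S \<in> ?P"
      by (rule contrapos_np) (rule p_simplex(2))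
  qed
  then have opt: "embed_pmf p \<in> cut_distributions G"
    by (simp add: cut_distributions_def)
  have "fault_value D k G \<le> fault_value (embed_pmf p) k G"
    if "D \<in> cut_distributions G" for D
    using bspec[OF p(2) mem[OF that]] by (simp only: val[OF that] val[OF opt] pmf)
  then show ?thesis
    unfolding is_arg_max_linorder using opt by (intro exI conjI allI impI)
qed

theorem theorem37:
  fixes G :: "'a wgraph" and k :: nat
  assumes "wf_wgraph G"
    and "k \<le> card (verts G)"
  shows "\<exists>Dmax. is_arg_max (\<lambda>D. fault_value D k G) (\<lambda>D. D \<in> cut_distributions G) Dmax \<and>
           fault_value (uniform_cut G) k G \<ge> 1 / 2 * fault_value Dmax k G"
  using ex_max_fault_value[OF assms] uniform_cut_half_approx[OF assms] by blast

end
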